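(* Let $m\geq2$ be an integer, let $\mathcal H$ be a complex Hilbert space, let $T\in\mathcal B(\mathcal H)$ be an analytic, norm-increasing $m$-concave operator, let $T'=T(T^*T)^{-1}$ be its Cauchy dual, and let $\mathcal M=\mathcal H\ominus[\ker T^*]_T$. If $T$ does not have the wandering subspace property, then for any $\lambda\in\sigma_{ap}(T'|_{\mathcal M})$ there exists a Weyl sequence in $\mathcal M$ for both $(\lambda,T)$ and $(\lambda,T')$. In this case, $\mathcal M$ is infinite-dimensional.
   Context: $\mathcal B(\mathcal H)$ is the algebra of bounded linear operators on $\mathcal H$. $T$ is analytic if $\bigcap_{n\geq0}T^n\mathcal H=\{0\}$. Put $\Delta_{m,T}=\sum_{k=0}^m(-1)^k\binom mk T^{*k}T^k$. $T$ is norm-increasing if $\Delta_{1,T}\leq0$ (i.e. $T^*T\geq I$), and, for $m\geq2$, $m$-concave if $(-1)^m\Delta_{m,T}\leq0$. For a subspace $\mathcal N$, $[\mathcal N]_T$ is the closed linear span of $\{T^nh:n\geq0,\,h\in\mathcal N\}$. $T$ has the wandering subspace property if $\mathcal H=[\ker T^*]_T$. The subspace $\mathcal M$ is invariant under $T'$, and $\sigma_{ap}(T'|_{\mathcal M})$ is the approximate point spectrum of $T'|_{\mathcal M}$ as an operator on $\mathcal M$. A Weyl sequence for $(\lambda,S)$, with $\lambda\in\mathbb C$ and $S\in\mathcal B(\mathcal H)$, is a weakly null sequence $\{u_n\}_{n\geq1}$ of unit vectors such that $(S-\lambda)u_n\to0$ as $n\to\infty$; "a Weyl sequence in $\mathcal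 M$ for both" means a single sequence contained in $\mathcal M$ that is a Weyl sequence for both pairs. *)

theory Defs
  imports "HOL-Analysis.Analysis"
begin

section \<open>Complex Hilbert spaces\<close>

text \<open>A complex Hilbert space is a real Hilbert space of the library carrying a compatible complex
  scalar multiplication and a sesquilinear form, linear in its first argument, whose real part is
  the real inner product. Norm, topology and completeness are those of the real structure, and
  positive definiteness of the form is inherited from it (see \<open>cinner_self\<close>).\<close>

class complex_vector = real_vector +
  fixes scaleC :: "complex \<Rightarrow> 'a \<Rightarrow> 'a" (infixr "*\<^sub>C" 75)
  assumes scaleC_add_right: "c *\<^sub>C (x + y) = c *\<^sub>C x + c *\<^sub>C y"
    and scaleC_add_left: "(c + d) *\<^sub>C x = c *\<^sub>C x + d *\<^sub>C x"
    and scaleC_scaleC: "c *\<^sub>C (d *\<^sub>C x) = (c * d) *\<^sub>C x"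
    and scaleC_one: "1 *\<^sub>C x = x"
    and scaleR_scaleC: "r *\<^sub>R x = complex_of_real r *\<^sub>C x"

global_interpretation complex_vector: vector_space "scaleC :: complex \<Rightarrow> 'a \<Rightarrow> 'a::complex_vector"
  defines cspan = complex_vector.span
  by unfold_locales
    (simp_all add: scaleC_add_right scaleC_add_left scaleC_scaleC scaleC_one)

class complex_inner = complex_vector + real_inner +
  fixes cinner :: "'a \<Rightarrow> 'a \<Rightarrow> complex"
  assumes cinner_commute: "cinner x y = cnj (cinner y x)"
    and cinner_add_left: "cinner (x + y) z = cinner x z + cinner y z"
    and cinner_scaleC_left: "cinner (c *\<^sub>C x) y = c * cinner x y"
    and Re_cinner: "Re (cinner x y) = inner x y"

class complex_hilbert = complex_inner + complete_space

lemma cinner_self: "cinner x x = complex_of_real ((norm x)\<^sup>2)"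
  for x :: "'a::complex_inner"
proof (rule complex_eqI)
  show "Re (cinner x x) = Re (complex_of_real ((norm x)\<^sup>2))"
    by (simp add: Re_cinner power2_norm_eq_inner)
  have "Im (cinner x x) = - Im (cinner x x)"
    by (metis cinner_commute cnj.sel(2))
  then show "Im (cinner x x) = Im (complex_of_real ((norm x)\<^sup>2))"
    by simp
qed

instantiation complex :: complex_hilbert
begin

definition scaleC_complex :: "complex \<Rightarrow> complex \<Rightarrow> complex"
  where "scaleC_complex c x = c * x"

definition cinner_complex :: "complex \<Rightarrow> complex \<Rightarrow> complex"
  where "cinner_complex x y = x * cnj y"

instance
  by standard
    (simp_all add: scaleC_complex_def cinner_complex_def inner_complex_def algebra_simps
      scaleR_conv_of_real)

end

section \<open>Bounded operators\<close>

definition bounded_clinear :: "('a::complex_hilbert \<Rightarrow> 'a) \<Rightarrow> bool"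
  where "bounded_clinear T \<longleftrightarrow> bounded_linear T \<and> (\<forall>c x. T (c *\<^sub>C x) = c *\<^sub>C T x)"

text \<open>For bounded \<open>T\<close> the Hilbert space adjoint exists by the Riesz representation theorem and is
  uniquely determined by the defining identity; the library function \<open>adjoint\<close> is defined in the
  same way from the real inner product.\<close>

definition cadjoint :: "('a::complex_hilbert \<Rightarrow> 'a) \<Rightarrow> 'a \<Rightarrow> 'a"
  where "cadjoint T = (SOME S. \<forall>x y. cinner (T x) y = cinner x (S y))"

definition nonpos_operator :: "('a::complex_hilbert \<Rightarrow> 'a) \<Rightarrow> bool"
  where "nonpos_operator A \<longleftrightarrow> (\<forall>x. cinner (A x) x \<in> \<real> \<and> Re (cinner (A x) x) \<le> 0)"

definition analytic_operator :: "('a::complex_hilbert \<Rightarrow> 'a) \<Rightarrow> bool"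
  where "analytic_operator T \<longleftrightarrow> (\<Inter>n. range (T ^^ n)) = {0}"

definition defect :: "nat \<Rightarrow> ('a::complex_hilbert \<Rightarrow> 'a) \<Rightarrow> 'a \<Rightarrow> 'a"
  where "defect m T = (\<lambda>x. \<Sum>k\<le>m. ((- 1) ^ k * real (m choose k)) *\<^sub>R
           (cadjoint T ^^ k) ((T ^^ k) x))"

definition norm_increasing :: "('a::complex_hilbert \<Rightarrow> 'a) \<Rightarrow> bool"
  where "norm_increasing T \<longleftrightarrow> nonpos_operator (defect 1 T)"

definition concave_operator :: "nat \<Rightarrow> ('a::complex_hilbert \<Rightarrow> 'a) \<Rightarrow> bool"
  where "concave_operator m T \<longleftrightarrow> nonpos_operator (\<lambda>x. (- 1) ^ m *\<^sub>R defect m T x)"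

text \<open>The inverse below is the function inverse; it is a genuine inverse whenever \<open>T\<^sup>*T\<close> is
  invertible, in particular for norm-increasing \<open>T\<close>.\<close>

definition cauchy_dual :: "('a::complex_hilbert \<Rightarrow> 'a) \<Rightarrow> 'a \<Rightarrow> 'a"
  where "cauchy_dual T = T \<circ> inv (cadjoint T \<circ> T)"

section \<open>Subspaces\<close>

definition generated_invariant :: "('a::complex_hilbert \<Rightarrow> 'a) \<Rightarrow> 'a set \<Rightarrow> 'a set"
  where "generated_invariant T N = closure (cspan {(T ^^ n) h | n h. h \<in> N})"

definition op_kernel :: "('a::complex_hilbert \<Rightarrow> 'a) \<Rightarrow> 'a set"
  where "op_kernel T = {x. T x = 0}"

definition wandering_subspace_property :: "('a::complex_hilbert \<Rightarrow> 'a) \<Rightarrow> bool"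
  where "wandering_subspace_property T \<longleftrightarrow>
           generated_invariant T (op_kernel (cadjoint T)) = UNIV"

definition corthogonal_complement :: "'a::complex_hilbert set \<Rightarrow> 'a set"
  where "corthogonal_complement N = {x. \<forall>y\<in>N. cinner x y = 0}"

definition infinite_dimensional :: "'a::complex_hilbert set \<Rightarrow> bool"
  where "infinite_dimensional M \<longleftrightarrow> \<not> (\<exists>B. finite B \<and> cspan B = M)"

section \<open>Approximate spectra\<close>

text \<open>The approximate point spectrum of the restriction of \<open>S\<close> to an \<open>S\<close>-invariant closed
  subspace \<open>M\<close>, regarded as an operator on the Hilbert space \<open>M\<close> with the inherited norm.\<close>

definition approx_point_spectrum_on :: "'a::complex_hilbert set \<Rightarrow> ('a \<Rightarrow> 'a) \<Rightarrow> complex set"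
  where "approx_point_spectrum_on M S =
    {c. \<exists>x :: nat \<Rightarrow> 'a. (\<forall>n. x n \<in> M \<and> norm (x n) = 1) \<and>
           (\<lambda>n. S (x n) - c *\<^sub>C x n) \<longlonglongrightarrow> 0}"

definition weakly_null :: "(nat \<Rightarrow> 'a::complex_hilbert) \<Rightarrow> bool"
  where "weakly_null u \<longleftrightarrow> (\<forall>y. (\<lambda>n. cinner (u n) y) \<longlonglongrightarrow> 0)"

definition weyl_sequence :: "complex \<Rightarrow> ('a::complex_hilbert \<Rightarrow> 'a) \<Rightarrow> (nat \<Rightarrow> 'a) \<Rightarrow> bool"
  where "weyl_sequence c S u \<longleftrightarrow>
           weakly_null u \<and> (\<forall>n. norm (u n) = 1) \<and> (\<lambda>n. S (u n) - c *\<^sub>C u n) \<longlonglongrightarrow> 0"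

end

theory Submission
  imports Defs "HOL-Computational_Algebra.Fundamental_Theorem_Algebra"
begin

text \<open>
  Write \<open>T'\<close> for the Cauchy dual and let \<open>x n\<close> be unit vectors with \<open>T' (x n) - c x n \<longlonglongrightarrow> 0\<close>. The claim
  is that every such sequence is already a Weyl sequence for both operators, and the reason is that
  \<open>c\<close> has modulus \<open>1\<close>.

  The operator \<open>T'\<close> is a contraction, so \<open>cmod c \<le> 1\<close>. On the other hand \<open>T\<^sup>* T'\<close> is the identity, so
  \<open>inverse c\<close> is an approximate eigenvalue of \<open>T\<^sup>*\<close>. By \<open>m\<close>-concavity the sequence
  \<open>n \<mapsto> (norm ((T ^^ n) x))\<^sup>2\<close> has nonpositive \<open>m\<close>-th differences and hence grows at most polynomially,
  uniformly on the unit ball (\<open>concave_operator_growth\<close>). The powers of \<open>T\<^sup>*\<close> have the same norms as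
  those of \<open>T\<close>, which excludes approximate eigenvalues of \<open>T\<^sup>*\<close> outside the unit disc
  (\<open>cadjoint_approx_eigenvalue_norm_le_1\<close>). Hence \<open>cmod c \<ge> 1\<close>.

  Now \<open>norm (T' (x n)) \<longlonglongrightarrow> 1\<close>. As \<open>T\<^sup>*T\<close> has a contractive inverse, \<open>norm_inv_Gram_diff\<close> shows that this
  inverse asymptotically fixes \<open>x n\<close>; consequently \<open>T (x n) - T' (x n) \<longlonglongrightarrow> 0\<close>, and the \<open>x n\<close> are
  approximate eigenvectors of \<open>T\<close> as well. Analyticity rules out genuine eigenvectors of \<open>T\<close> for \<open>c\<close>,
  so the adjoint of \<open>T - c\<close> has dense range, and testing against this range shows that \<open>x n\<close> tends
  weakly to \<open>0\<close> (\<open>analytic_approx_eigenvector_weakly_null\<close>).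

  In particular \<open>T'\<close> has no eigenvectors at all. The subspace \<open>M\<close> is nonzero if the wandering subspace
  property fails, it is invariant under \<open>T\<^sup>*\<close>, and \<open>T'\<close> inverts \<open>T\<^sup>*\<close> on it. If \<open>M\<close> were
  finite-dimensional, \<open>T\<^sup>*\<close> would have an eigenvector in \<open>M\<close>, and so would \<open>T'\<close>.
\<close>

section \<open>Orthogonal projection and Riesz representation\<close>

lemma parallelogram_law:
  fixes u v :: "'a::real_inner"
  shows "(norm (u - v))\<^sup>2 = 2 * (norm u)\<^sup>2 + 2 * (norm v)\<^sup>2 - (norm (u + v))\<^sup>2"
  by (simp add: power2_norm_eq_inner inner_simps inner_commute)

lemma norm_diff_scaleR_square:
  fixes u z :: "'a::real_inner"
  shows "(norm (u - t *\<^sub>R z))\<^sup>2 = (norm u)\<^sup>2 - 2 * t * inner u z + t\<^sup>2 * (norm z)\<^sup>2"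
  unfolding power2_norm_eq_inner
  by (simp add: inner_diff_left inner_diff_right inner_commute[of z u] power2_eq_square algebra_simps)

text \<open>A minimizing sequence for the distance from \<open>x\<close> to \<open>S\<close> is Cauchy by the parallelogram law, because
  the midpoint of two of its terms is again at least the minimal distance away from \<open>x\<close>. Its limit
  is a nearest point, and moving a nearest point along \<open>z \<in> S\<close> cannot shorten the distance,
  which forces orthogonality.\<close>

lemma orthogonal_projection_exists:
  fixes S :: "'a::{real_inner,complete_space} set"
  assumes S: "subspace S" and cl: "closed S"
  obtains p where "p \<in> S" "\<And>y. y \<in> S \<Longrightarrow> inner (x - p) y = 0"
proof -
  define D where "D = Inf ((\<lambda>y. (norm (x - y))\<^sup>2) ` S)"
  have bdd: "bdd_below ((\<lambda>y. (norm (x - y))\<^sup>2) ` S)"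
    by (rule bdd_belowI[of _ 0]) auto
  have ne: "S \<noteq> {}"
    using subspace_0[OF S] by auto
  have D_le: "D \<le> (norm (x - y))\<^sup>2" if "y \<in> S" for y
    unfolding D_def using that bdd by (intro cInf_lower) auto
  have "\<exists>y\<in>S. (norm (x - y))\<^sup>2 < D + 1 / Suc n" for n
  proof -
    have "D < D + 1 / Suc n" by simp
    then show ?thesis
      using cInf_lessD[of "(\<lambda>y. (norm (x - y))\<^sup>2) ` S" "D + 1 / Suc n"] ne
      unfolding D_def[symmetric] by auto
  qed
  then obtain y where y: "\<And>n. y n \<in> S" "\<And>n. (norm (x - y n))\<^sup>2 < D + 1 / Suc n"
    by metis
  have close: "(norm (y i - y j))\<^sup>2 \<le> 2 / Suc i + 2 / Suc j" for i j
  proof -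
    have mid: "(1/2) *\<^sub>R (y i + y j) \<in> S"
      using y S by (simp add: subspace_add subspace_scale)
    have "(x - y j) + (x - y i) = 2 *\<^sub>R (x - (1/2) *\<^sub>R (y i + y j))"
      by (simp add: algebra_simps scaleR_2)
    then have "(norm ((x - y j) + (x - y i)))\<^sup>2 = 4 * (norm (x - (1/2) *\<^sub>R (y i + y j)))\<^sup>2"
      by (simp add: power2_eq_square)
    moreover have "y i - y j = (x - y j) - (x - y i)" by simp
    ultimately have "(norm (y i - y j))\<^sup>2 = 2 * (norm (x - y j))\<^sup>2 + 2 * (norm (x - y i))\<^sup>2
        - 4 * (norm (x - (1/2) *\<^sub>R (y i + y j)))\<^sup>2"
      using parallelogram_law[of "x - y j" "x - y i"] by metis
    then show ?thesis
      using D_le[OF mid] y(2)[of i] y(2)[of j] by simp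
  qed
  have "Cauchy y"
  proof (rule metric_CauchyI)
    fix e :: real assume e: "e > 0"
    obtain N where N: "4 / e\<^sup>2 < real N" using reals_Archimedean2 by blast
    have "dist (y i) (y j) < e" if "N \<le> i" "N \<le> j" for i j
    proof -
      have "4 < e\<^sup>2 * real (Suc N)"
        using N e by (simp add: field_simps add_strict_increasing)
      then have "4 / Suc N < e\<^sup>2"
        by (simp add: field_simps)
      moreover have "2 / Suc i \<le> 2 / Suc N" "2 / Suc j \<le> 2 / Suc N"
        using that by (auto intro!: divide_left_mono)
      ultimately have "(norm (y i - y j))\<^sup>2 < e\<^sup>2"
        using close[of i j] add_divide_distrib[of 2 2 "real (Suc N)"] by linarith
      then show ?thesis using e by (simp add: dist_norm power2_less_imp_less)
    qed
    then show "\<exists>N. \<forall>i\<ge>N. \<forall>j\<ge>N. dist (y i) (y j) < e" by blast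
  qed
  then obtain p where p: "y \<longlonglongrightarrow> p"
    using Cauchy_convergent convergent_def by blast
  have pS: "p \<in> S" using cl p y(1) closed_sequentially by blast
  have "(\<lambda>n. (norm (x - y n))\<^sup>2) \<longlonglongrightarrow> (norm (x - p))\<^sup>2"
    by (intro tendsto_intros p)
  moreover have "(\<lambda>n. D + 1 / Suc n) \<longlonglongrightarrow> D + 0"
    by (intro tendsto_intros LIMSEQ_inverse_real_of_nat[unfolded inverse_eq_divide])
  ultimately have min: "(norm (x - p))\<^sup>2 \<le> D"
    using y(2) by (metis (no_types, lifting) LIMSEQ_le add.right_neutral less_imp_le)
  have "inner (x - p) z = 0" if z: "z \<in> S" for z
  proof (cases "z = 0")
    case False
    \<comment> \<open>The step length along \<open>z\<close> that minimizes the quadratic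
      \<open>t \<mapsto> (norm (x - p - t *\<^sub>R z))\<^sup>2\<close>.\<close>
    let ?t = "inner (x - p) z / (norm z)\<^sup>2"
    have "p + ?t *\<^sub>R z \<in> S" using pS z S by (simp add: subspace_add subspace_scale)
    then have "(norm (x - p))\<^sup>2 \<le> (norm ((x - p) - ?t *\<^sub>R z))\<^sup>2"
      using D_le min by (smt (verit) diff_diff_eq)
    also have "\<dots> = (norm (x - p))\<^sup>2 - 2 * ?t * inner (x - p) z + ?t\<^sup>2 * (norm z)\<^sup>2"
      by (rule norm_diff_scaleR_square)
    also have "\<dots> = (norm (x - p))\<^sup>2 - (inner (x - p) z)\<^sup>2 / (norm z)\<^sup>2"
      using False by (simp add: power2_eq_square field_simps)
    finally have "(inner (x - p) z)\<^sup>2 / (norm z)\<^sup>2 \<le> 0" by simp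
    then show ?thesis using False by (simp add: divide_le_0_iff)
  qed simp
  with pS that show thesis by blast
qed

lemma closed_subspace_eq_UNIV:
  fixes S :: "'a::{real_inner,complete_space} set"
  assumes "subspace S" "closed S" and "\<And>x. (\<And>y. y \<in> S \<Longrightarrow> inner x y = 0) \<Longrightarrow> x = 0"
  shows "S = UNIV"
proof -
  have "x \<in> S" for x
  proof -
    obtain p where "p \<in> S" "\<And>y. y \<in> S \<Longrightarrow> inner (x - p) y = 0"
      using orthogonal_projection_exists[OF assms(1,2)] by blast
    with assms(3)[of "x - p"] show ?thesis by simp
  qed
  then show ?thesis by blast
qed

lemma subspace_closure:
  fixes S :: "'a::real_normed_vector set"
  assumes S: "subspace S"
  shows "subspace (closure S)"
  unfolding subspace_def
proof (intro conjI ballI allI)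
  show "0 \<in> closure S" using subspace_0[OF S] closure_subset by blast
next
  fix x y assume "x \<in> closure S" "y \<in> closure S"
  then obtain f g where "\<And>n. f n \<in> S" "f \<longlonglongrightarrow> x" "\<And>n. g n \<in> S" "g \<longlonglongrightarrow> y"
    unfolding closure_sequential by blast
  then show "x + y \<in> closure S"
    unfolding closure_sequential
    by (intro exI[of _ "\<lambda>n. f n + g n"]) (auto intro: tendsto_add subspace_add[OF S])
next
  fix x and c :: real assume "x \<in> closure S"
  then obtain f where "\<And>n. f n \<in> S" "f \<longlonglongrightarrow> x"
    unfolding closure_sequential by blast
  then show "c *\<^sub>R x \<in> closure S"
    unfolding closure_sequential
    by (intro exI[of _ "\<lambda>n. c *\<^sub>R f n"]) (auto intro!: tendsto_intros subspace_scale[OF S])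
qed

text \<open>The kernel of a nonzero functional \<open>f\<close> has a one-dimensional orthogonal complement; any nonzero vector
  \<open>e\<close> in it represents \<open>f\<close> up to a scalar.\<close>

lemma riesz_representation:
  fixes f :: "'a::{real_inner,complete_space} \<Rightarrow> real"
  assumes "bounded_linear f"
  shows "\<exists>z. \<forall>x. f x = inner x z"
proof (cases "\<forall>x. f x = 0")
  case True
  then show ?thesis by (intro exI[of _ 0]) simp
next
  case False
  then obtain w where w: "f w \<noteq> 0" by blast
  interpret f: bounded_linear f by fact
  have "closed {x. f x = 0}"
    by (intro closed_Collect_eq continuous_intros f.continuous_on)
  moreover have "subspace {x. f x = 0}"
    by (auto simp: subspace_def f.add f.scaleR)
  ultimately obtain p where p: "f p = 0" "\<And>y. f y = 0 \<Longrightarrow> inner (w - p) y = 0"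
    using orthogonal_projection_exists[of "{x. f x = 0}" w] by auto
  define e where "e = w - p"
  have fe: "f e \<noteq> 0" using w p by (simp add: e_def f.diff)
  then have ne: "(norm e)\<^sup>2 \<noteq> 0" by (auto simp: f.zero)
  have "f x = inner x ((f e / (norm e)\<^sup>2) *\<^sub>R e)" for x
  proof -
    have "f (x - (f x / f e) *\<^sub>R e) = 0" using fe by (simp add: f.diff f.scaleR)
    then have "inner e (x - (f x / f e) *\<^sub>R e) = 0" unfolding e_def by (rule p(2))
    then have "inner e x = f x / f e * (norm e)\<^sup>2"
      by (simp add: inner_simps power2_norm_eq_inner)
    with fe ne show ?thesis by (simp add: inner_commute)
  qed
  then show ?thesis by blast
qed

section \<open>The complex inner product and its adjoint\<close>

text \<open>All estimates below are made with the real inner product; this formula carries orthogonality,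
  continuity and limits back to the complex form.\<close>

lemma cinner_conv_inner: "cinner x y = Complex (inner x y) (inner (- \<i> *\<^sub>C x) y)"
proof -
  have "inner (- \<i> *\<^sub>C x) y = Re (- \<i> * cinner x y)"
    by (metis Re_cinner cinner_scaleC_left)
  then show ?thesis by (simp add: complex_eq_iff Re_cinner)
qed

lemma cinner_scaleC_right: "cinner x (c *\<^sub>C y) = cnj c * cinner x y"
  by (metis cinner_commute cinner_scaleC_left complex_cnj_mult complex_cnj_cnj)

lemma inner_scaleC_right: "inner x (c *\<^sub>C y) = inner (cnj c *\<^sub>C x) y"
  for x y :: "'a::complex_inner"
  by (simp flip: Re_cinner add: cinner_scaleC_left cinner_scaleC_right)

lemma norm_scaleC: "norm (c *\<^sub>C x) = cmod c * norm x"
  for x :: "'a::complex_inner"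
proof -
  have "complex_of_real ((norm (c *\<^sub>C x))\<^sup>2) = (c * cnj c) * complex_of_real ((norm x)\<^sup>2)"
    unfolding cinner_self[symmetric] by (simp add: cinner_scaleC_left cinner_scaleC_right)
  also have "\<dots> = complex_of_real ((cmod c * norm x)\<^sup>2)"
    by (simp only: complex_norm_square[symmetric] of_real_mult[symmetric] power_mult_distrib)
  finally have "(norm (c *\<^sub>C x))\<^sup>2 = (cmod c * norm x)\<^sup>2"
    using of_real_eq_iff by blast
  then show ?thesis by simp
qed

lemma bounded_linear_scaleC: "bounded_linear (\<lambda>x::'a::complex_inner. c *\<^sub>C x)"
  by (rule bounded_linear_intro[where K="cmod c"])
    (simp_all add: scaleC_add_right scaleR_scaleC scaleC_scaleC norm_scaleC mult.commute)

lemma bounded_clinear_bounded_linear: "bounded_clinear T \<Longrightarrow> bounded_linear T"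
  and bounded_clinear_scaleC: "bounded_clinear T \<Longrightarrow> T (c *\<^sub>C x) = c *\<^sub>C T x"
  by (simp_all add: bounded_clinear_def)

text \<open>Riesz representation gives an adjoint for the real inner product. It is also the adjoint for the
  complex form: by \<open>cinner_conv_inner\<close> the imaginary part is the real inner product with \<open>x\<close> replaced by
  \<open>- \<i> *\<^sub>C x\<close>, and \<open>T\<close> is complex linear.\<close>

lemma cinner_cadjoint:
  fixes T :: "'a::complex_hilbert \<Rightarrow> 'a"
  assumes T: "bounded_clinear T"
  shows "cinner (T x) y = cinner x (cadjoint T y)"
proof -
  interpret T: bounded_linear T using T by (rule bounded_clinear_bounded_linear)
  have "\<exists>z. \<forall>x. inner (T x) y = inner x z" for y
    by (rule riesz_representation)
      (rule bounded_linear_compose[OF bounded_linear_inner_left T.bounded_linear_axioms])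
  then obtain S where S: "\<And>x y. inner (T x) y = inner x (S y)" by metis
  have "cinner (T x) y = cinner x (S y)" for x y
    unfolding cinner_conv_inner
    by (simp add: S flip: bounded_clinear_scaleC[OF T])
  then have "\<exists>S. \<forall>x y. cinner (T x) y = cinner x (S y)" by blast
  then show ?thesis unfolding cadjoint_def by (rule someI2_ex) blast
qed

lemma inner_cadjoint:
  "bounded_clinear T \<Longrightarrow> inner (T x) y = inner x (cadjoint T y)"
  by (simp flip: Re_cinner add: cinner_cadjoint)

lemma inner_eqI: "(\<And>z. inner z x = inner z y) \<Longrightarrow> x = y"
  for x y :: "'a::real_inner"
  by (metis inner_eq_zero_iff inner_diff_right right_minus_eq)

lemma bounded_clinear_cadjoint:
  fixes T :: "'a::complex_hilbert \<Rightarrow> 'a"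
  assumes T: "bounded_clinear T"
  shows "bounded_clinear (cadjoint T)"
proof -
  interpret T: bounded_linear T using T by (rule bounded_clinear_bounded_linear)
  have scale: "cadjoint T (c *\<^sub>C x) = c *\<^sub>C cadjoint T x" for c x
    by (rule inner_eqI)
      (simp add: inner_scaleC_right bounded_clinear_scaleC[OF T] flip: inner_cadjoint[OF T])
  obtain K where K: "K \<ge> 0" "\<And>x. norm (T x) \<le> norm x * K"
    using T.nonneg_bounded by blast
  have bound: "norm (cadjoint T x) \<le> norm x * K" for x
  proof -
    let ?y = "cadjoint T x"
    have "(norm ?y)\<^sup>2 = inner (T ?y) x"
      by (simp add: inner_cadjoint[OF T] power2_norm_eq_inner)
    also have "\<dots> \<le> norm (T ?y) * norm x" by (rule norm_cauchy_schwarz)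
    also have "\<dots> \<le> (norm ?y * K) * norm x" by (intro mult_right_mono K(2)) simp
    finally have "norm ?y * norm ?y \<le> norm ?y * (norm x * K)"
      by (simp add: power2_eq_square mult_ac)
    then show ?thesis
      using K(1) by (cases "norm ?y = 0") (simp_all add: mult_le_cancel_left)
  qed
  have "bounded_linear (cadjoint T)"
  proof (rule bounded_linear_intro[OF _ _ bound])
    show "cadjoint T (x + y) = cadjoint T x + cadjoint T y" for x y
      by (rule inner_eqI) (simp add: inner_add_right flip: inner_cadjoint[OF T])
    show "cadjoint T (r *\<^sub>R x) = r *\<^sub>R cadjoint T x" for r x
      by (simp add: scale scaleR_scaleC)
  qed
  with scale show ?thesis by (simp add: bounded_clinear_def)
qed

lemma inner_cadjoint_funpow:
  assumes T: "bounded_clinear T"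
  shows "inner ((T ^^ n) x) y = inner x ((cadjoint T ^^ n) y)"
  by (induction n arbitrary: x y) (simp_all add: inner_cadjoint[OF T] funpow_swap1)

section \<open>Polynomial growth of \<open>m\<close>-concave operators\<close>

text \<open>The \<open>m\<close>-th iterated forward difference of \<open>b\<close> at \<open>0\<close>, in closed form: this is the shape in which
  the defect operator produces it.\<close>

definition forward_difference :: "nat \<Rightarrow> (nat \<Rightarrow> real) \<Rightarrow> real"
  where "forward_difference m b = (- 1) ^ m * (\<Sum>k\<le>m. (- 1) ^ k * real (m choose k) * b k)"

lemma forward_difference_Suc:
  "forward_difference (Suc m) b = forward_difference m (\<lambda>k. b (Suc k) - b k)"
proof -
  have "(\<Sum>k\<le>Suc m. (- 1) ^ k * real (Suc m choose k) * b k)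
      = (b 0 + (\<Sum>k\<le>m. (- 1) ^ Suc k * real (m choose Suc k) * b (Suc k)))
        - (\<Sum>k\<le>m. (- 1) ^ k * real (m choose k) * b (Suc k))"
    by (subst sum.atMost_Suc_shift)
      (simp add: algebra_simps sum.distrib sum_negf sum_subtractf)
  also have "b 0 + (\<Sum>k\<le>m. (- 1) ^ Suc k * real (m choose Suc k) * b (Suc k))
      = (\<Sum>k\<le>Suc m. (- 1) ^ k * real (m choose k) * b k)"
    by (subst sum.atMost_Suc_shift) simp
  also have "\<dots> = (\<Sum>k\<le>m. (- 1) ^ k * real (m choose k) * b k)"
    by (simp add: binomial_eq_0)
  finally have "(\<Sum>k\<le>Suc m. (- 1) ^ k * real (Suc m choose k) * b k)
      = - (\<Sum>k\<le>m. (- 1) ^ k * real (m choose k) * (b (Suc k) - b k))"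
    by (simp add: right_diff_distrib sum_subtractf del: sum.atMost_Suc)
  then show ?thesis by (simp add: forward_difference_def del: sum.atMost_Suc)
qed

text \<open>A sequence whose \<open>m\<close>-th differences are nowhere positive stays below a polynomial of degree less
  than \<open>m\<close>. Summing the bound for the first differences raises each power by one, and the crude
  estimate \<open>(\<Sum>i<n. i ^ j) \<le> n ^ Suc j\<close> keeps the coefficients simple; only the order of growth
  matters later.\<close>

lemma nonpos_forward_difference_growth:
  assumes "\<And>n. forward_difference m (\<lambda>k. b (n + k)) \<le> 0"
  shows "b n \<le> (\<Sum>j<m. real n ^ j * \<bar>forward_difference j b\<bar>)"
  using assms
proof (induction m arbitrary: b n)
  case 0
  from 0[of n] show ?case by (simp add: forward_difference_def)
next
  case (Suc m)
  let ?g = "\<lambda>k. b (Suc k) - b k"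
  have g: "?g i \<le> (\<Sum>j<m. real i ^ j * \<bar>forward_difference j ?g\<bar>)" for i
    using Suc.prems by (intro Suc.IH) (simp add: forward_difference_Suc)
  have "b n - b 0 = (\<Sum>i<n. ?g i)"
    by (rule sum_lessThan_telescope[symmetric])
  also have "\<dots> \<le> (\<Sum>i<n. \<Sum>j<m. real n ^ j * \<bar>forward_difference j ?g\<bar>)"
  proof (rule sum_mono)
    fix i assume "i \<in> {..<n}"
    then show "?g i \<le> (\<Sum>j<m. real n ^ j * \<bar>forward_difference j ?g\<bar>)"
      by (intro order_trans[OF g] sum_mono mult_right_mono power_mono) auto
  qed
  also have "\<dots> = (\<Sum>j<m. real n ^ Suc j * \<bar>forward_difference (Suc j) b\<bar>)"
    by (simp add: forward_difference_Suc sum_distrib_left mult.assoc)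
  finally have "b n \<le> \<bar>forward_difference 0 b\<bar>
      + (\<Sum>j<m. real n ^ Suc j * \<bar>forward_difference (Suc j) b\<bar>)"
    by (simp add: forward_difference_def)
  then show ?case
    by (simp only: sum.lessThan_Suc_shift power_0 mult_1)
qed

lemma inner_defect:
  assumes T: "bounded_clinear T"
  shows "inner ((- 1) ^ m *\<^sub>R defect m T x) x = forward_difference m (\<lambda>k. (norm ((T ^^ k) x))\<^sup>2)"
proof -
  have "inner ((cadjoint T ^^ k) ((T ^^ k) x)) x = (norm ((T ^^ k) x))\<^sup>2" for k
    by (metis inner_cadjoint_funpow[OF T] inner_commute power2_norm_eq_inner)
  then show ?thesis
    by (simp add: defect_def forward_difference_def inner_sum_left)
qed

text \<open>Concavity, applied to all vectors \<open>(T ^^ n) x\<close>, says that the \<open>m\<close>-th differences of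
  \<open>n \<mapsto> (norm ((T ^^ n) x))\<^sup>2\<close> are nonpositive. The coefficients of the resulting polynomial bound
  are differences at \<open>0\<close>, hence at most a constant times \<open>(norm x)\<^sup>2\<close>. The uniformity in \<open>x\<close>
  makes this a bound for operator norms: the spectral radius of \<open>T\<close> is at most \<open>1\<close>.\<close>

lemma concave_operator_growth:
  fixes T :: "'a::complex_hilbert \<Rightarrow> 'a"
  assumes T: "bounded_clinear T" and conc: "concave_operator m T"
  obtains C where "C \<ge> 0" "\<And>n x. (norm ((T ^^ n) x))\<^sup>2 \<le> C * real (Suc n) ^ m * (norm x)\<^sup>2"
proof -
  interpret T: bounded_linear T using T by (rule bounded_clinear_bounded_linear)
  obtain K where K: "K \<ge> 0" "\<And>x. norm (T x) \<le> norm x * K"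
    using T.nonneg_bounded by blast
  have pow: "norm ((T ^^ k) x) \<le> norm x * K ^ k" for k x
  proof (induction k)
    case (Suc k)
    have "norm ((T ^^ Suc k) x) \<le> norm ((T ^^ k) x) * K" using K(2) by simp
    also have "\<dots> \<le> (norm x * K ^ k) * K" using Suc K(1) by (rule mult_right_mono)
    finally show ?case by (simp add: mult_ac)
  qed simp
  let ?b = "\<lambda>x k. (norm ((T ^^ k) x))\<^sup>2"
  define c where "c j = (\<Sum>k\<le>j. real (j choose k) * (K ^ k)\<^sup>2)" for j
  have c0: "c j \<ge> 0" for j unfolding c_def by (intro sum_nonneg) simp
  have fd: "\<bar>forward_difference j (?b x)\<bar> \<le> c j * (norm x)\<^sup>2" for j x
  proof -
    have "\<bar>forward_difference j (?b x)\<bar> = \<bar>\<Sum>k\<le>j. (- 1) ^ k * real (j choose k) * ?b x k\<bar>"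
      by (simp add: forward_difference_def abs_mult power_abs)
    also have "\<dots> \<le> (\<Sum>k\<le>j. \<bar>(- 1) ^ k * real (j choose k) * ?b x k\<bar>)" by (rule sum_abs)
    also have "\<dots> = (\<Sum>k\<le>j. real (j choose k) * ?b x k)"
      by (simp add: abs_mult power_abs)
    also have "\<dots> \<le> (\<Sum>k\<le>j. real (j choose k) * (norm x * K ^ k)\<^sup>2)"
      by (intro sum_mono mult_left_mono power_mono pow) auto
    finally show ?thesis
      by (simp add: c_def sum_distrib_left power_mult_distrib mult_ac)
  qed
  show thesis
  proof (rule that)
    show "0 \<le> (\<Sum>j<m. c j)" by (intro sum_nonneg c0)
    fix n x
    have "forward_difference m (\<lambda>k. ?b x (n' + k)) \<le> 0" for n'
    proof -
      have "(\<lambda>k. ?b x (n' + k)) = ?b ((T ^^ n') x)"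
        by (simp add: fun_eq_iff funpow_add add.commute)
      moreover have "forward_difference m (?b ((T ^^ n') x)) \<le> 0"
        using conc unfolding concave_operator_def nonpos_operator_def
        by (simp only: Re_cinner inner_defect[OF T])
      ultimately show ?thesis by simp
    qed
    then have "?b x n \<le> (\<Sum>j<m. real n ^ j * \<bar>forward_difference j (?b x)\<bar>)"
      by (rule nonpos_forward_difference_growth)
    also have "\<dots> \<le> (\<Sum>j<m. real (Suc n) ^ m * (c j * (norm x)\<^sup>2))"
    proof (intro sum_mono mult_mono fd)
      fix j assume j: "j \<in> {..<m}"
      have "real n ^ j \<le> real (Suc n) ^ j" by (intro power_mono) auto
      also have "\<dots> \<le> real (Suc n) ^ m" using j by (intro power_increasing) auto
      finally show "real n ^ j \<le> real (Suc n) ^ m" .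
    qed auto
    finally show "?b x n \<le> (\<Sum>j<m. c j) * real (Suc n) ^ m * (norm x)\<^sup>2"
      by (simp add: sum_distrib_left sum_distrib_right mult_ac)
  qed
qed

lemma power_le_polynomial_imp_le_1:
  fixes a C :: real
  assumes "a \<ge> 0" and "\<And>n. a ^ n \<le> C * real (Suc n) ^ m"
  shows "a \<le> 1"
proof (rule ccontr)
  assume "\<not> a \<le> 1"
  then have a: "a > 1" by simp
  have "(\<lambda>n. C * real (Suc n) ^ m / a ^ n) \<longlonglongrightarrow> 0"
    using a by real_asymp
  moreover have "1 \<le> C * real (Suc n) ^ m / a ^ n" for n
    using assms(2)[of n] a by (simp add: field_simps)
  ultimately have "(1::real) \<le> 0"
    by (intro LIMSEQ_le_const[where X="\<lambda>n. C * real (Suc n) ^ m / a ^ n"]) auto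
  then show False by simp
qed

section \<open>Eigenvectors in finite-dimensional invariant subspaces\<close>

text \<open>The vector \<open>p(f) x\<close>, evaluated by Horner's rule so that it can be computed by recursion on
  \<open>pCons\<close>.\<close>

definition poly_apply :: "('a::complex_vector \<Rightarrow> 'a) \<Rightarrow> complex poly \<Rightarrow> 'a \<Rightarrow> 'a"
  where "poly_apply f p x = fold_coeffs (\<lambda>a v. a *\<^sub>C x + f v) p 0"

context
  fixes f :: "'a::complex_vector \<Rightarrow> 'a"
  assumes add: "f (x + y) = f x + f y" and scale: "f (c *\<^sub>C x) = c *\<^sub>C f x"
begin

lemma poly_apply_0: "poly_apply f 0 x = 0"
  by (simp add: poly_apply_def)

lemma poly_apply_pCons: "poly_apply f (pCons a p) x = a *\<^sub>C x + f (poly_apply f p x)"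
proof -
  have "f 0 = 0" using scale[of 0 0] by simp
  then show ?thesis
    by (cases "a = 0 \<and> p = 0") (auto simp: poly_apply_def)
qed

lemma poly_apply_add: "poly_apply f (p + q) x = poly_apply f p x + poly_apply f q x"
  by (induction p q rule: poly_induct2)
    (simp_all add: poly_apply_0 poly_apply_pCons add scaleC_add_left)

lemma poly_apply_smult: "poly_apply f (smult c p) x = c *\<^sub>C poly_apply f p x"
  by (induction p)
    (simp_all add: poly_apply_0 poly_apply_pCons scale scaleC_add_right scaleC_scaleC)

lemma poly_apply_sum: "finite A \<Longrightarrow> poly_apply f (\<Sum>i\<in>A. p i) x = (\<Sum>i\<in>A. poly_apply f (p i) x)"
  by (induction A rule: finite_induct) (simp_all add: poly_apply_0 poly_apply_add)

lemma poly_apply_monom: "poly_apply f (monom a n) x = a *\<^sub>C (f ^^ n) x"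
proof (induction n)
  case 0
  have "f 0 = 0" using scale[of 0 0] by simp
  then show ?case by (simp add: monom_0 poly_apply_pCons poly_apply_0)
qed (simp add: monom_Suc poly_apply_pCons scale)

lemma poly_apply_linear_factor:
  "poly_apply f ([:- c, 1:] * q) x = f (poly_apply f q x) - c *\<^sub>C poly_apply f q x"
proof -
  have "[:- c, 1:] * q = smult (- c) q + pCons 0 q" by simp
  then show ?thesis
    by (simp only: poly_apply_add poly_apply_smult poly_apply_pCons) simp
qed

lemma poly_apply_in_subspace:
  assumes M: "complex_vector.subspace M" and inv: "\<And>v. v \<in> M \<Longrightarrow> f v \<in> M" and x: "x \<in> M"
  shows "poly_apply f p x \<in> M"
  by (induction p)
    (simp_all add: poly_apply_0 poly_apply_pCons complex_vector.subspace_0[OF M]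
      complex_vector.subspace_add[OF M] complex_vector.subspace_scale[OF M] inv x)

text \<open>Split off a root \<open>c\<close> of the annihilating polynomial, \<open>p = (X - c) q\<close>. If \<open>q(f) x \<noteq> 0\<close>, this vector
  is an eigenvector for \<open>c\<close>; otherwise \<open>q\<close> annihilates \<open>x\<close> as well and has smaller degree.\<close>

lemma annihilating_poly_imp_eigenvector:
  assumes M: "complex_vector.subspace M" and inv: "\<And>v. v \<in> M \<Longrightarrow> f v \<in> M"
    and x: "x \<in> M" "x \<noteq> 0" and p: "p \<noteq> 0" "poly_apply f p x = 0"
  shows "\<exists>c v. v \<in> M \<and> v \<noteq> 0 \<and> f v = c *\<^sub>C v"
  using p
proof (induction "degree p" arbitrary: p)
  case 0
  then obtain a where a: "p = [:a:]" by (metis degree_eq_zeroE)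
  have "f 0 = 0" using scale[of 0 0] by simp
  with a 0 x show ?case by (auto simp: poly_apply_pCons poly_apply_0)
next
  case (Suc n)
  then obtain c where "poly p c = 0"
    using fundamental_theorem_of_algebra[of p] constant_degree[of p] by auto
  then obtain q where q: "p = [:- c, 1:] * q" by (metis dvdE poly_eq_0_iff_dvd)
  show ?case
  proof (cases "poly_apply f q x = 0")
    case True
    have "q \<noteq> 0" using Suc.prems q by auto
    then have "degree p = Suc (degree q)"
      unfolding q by (subst degree_mult_eq) auto
    with Suc True \<open>q \<noteq> 0\<close> show ?thesis by auto
  next
    case False
    then show ?thesis
      using Suc.prems(2) poly_apply_in_subspace[OF M inv x(1)]
      unfolding q poly_apply_linear_factor by auto
  qed
qed

text \<open>The orbit of \<open>x\<close> consists of infinitely many vectors in a finite-dimensional space or repeats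
  itself. Either way it satisfies a nontrivial linear relation, which is an annihilating
  polynomial.\<close>

lemma finite_dimensional_imp_eigenvector:
  assumes B: "finite B" and M: "M = cspan B" and inv: "\<And>v. v \<in> M \<Longrightarrow> f v \<in> M"
    and x: "x \<in> M" "x \<noteq> 0"
  shows "\<exists>c v. v \<in> M \<and> v \<noteq> 0 \<and> f v = c *\<^sub>C v"
proof -
  have sub: "complex_vector.subspace M" unfolding M by simp
  let ?g = "\<lambda>n. (f ^^ n) x"
  have "\<exists>p. p \<noteq> 0 \<and> poly_apply f p x = 0"
  proof (cases "inj ?g")
    case False
    then obtain i j where ij: "i \<noteq> j" "?g i = ?g j" by (auto simp: inj_def)
    have "coeff (monom 1 i + monom (- 1) j :: complex poly) i = 1" using ij by simp
    then have "monom 1 i + monom (- 1) j \<noteq> (0 :: complex poly)" by force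
    moreover have "poly_apply f (monom 1 i + monom (- 1) j) x = 0"
      using ij by (simp add: poly_apply_add poly_apply_monom)
    ultimately show ?thesis by blast
  next
    case True
    have "?g n \<in> M" for n by (induction n) (simp_all add: x inv)
    then have "complex_vector.dependent (range ?g)"
      using complex_vector.independent_span_bound[OF B, of "range ?g"] range_inj_infinite[OF True]
      unfolding M by blast
    then obtain S u v where S: "finite S" "S \<subseteq> range ?g" "(\<Sum>v\<in>S. u v *\<^sub>C v) = 0"
        and v: "v \<in> S" "u v \<noteq> 0"
      unfolding complex_vector.dependent_explicit by blast
    from S(1,2) obtain I where I: "finite I" "S = ?g ` I" by (meson finite_subset_image)
    define p where "p = (\<Sum>i\<in>I. monom (u (?g i)) i)"
    have "poly_apply f p x = (\<Sum>i\<in>I. u (?g i) *\<^sub>C ?g i)"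
      by (simp add: p_def poly_apply_sum[OF I(1)] poly_apply_monom)
    also have "\<dots> = (\<Sum>v\<in>S. u v *\<^sub>C v)"
      unfolding I(2) by (subst sum.reindex) (auto intro: inj_on_subset[OF True])
    finally have "poly_apply f p x = 0" using S(3) by simp
    moreover obtain k where k: "k \<in> I" "v = ?g k" using v I by auto
    then have "coeff p k = u v" using I(1) by (simp add: p_def coeff_sum)
    then have "p \<noteq> 0" using v by auto
    ultimately show ?thesis by blast
  qed
  then show ?thesis using annihilating_poly_imp_eigenvector[OF sub inv x] by blast
qed

end

section \<open>The Cauchy dual of a norm-increasing operator\<close>

lemma cadjoint_funpow_norm_bound:
  fixes T :: "'a::complex_hilbert \<Rightarrow> 'a"
  assumes T: "bounded_clinear T" and B: "B \<ge> 0" "\<And>x. norm ((T ^^ n) x) \<le> B * norm x"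
  shows "norm ((cadjoint T ^^ n) x) \<le> B * norm x"
proof -
  let ?y = "(cadjoint T ^^ n) x"
  have "norm ?y * norm ?y = inner ((T ^^ n) ?y) x"
    by (metis inner_cadjoint_funpow[OF T] power2_norm_eq_inner power2_eq_square)
  also have "\<dots> \<le> norm ((T ^^ n) ?y) * norm x" by (rule norm_cauchy_schwarz)
  also have "\<dots> \<le> (B * norm ?y) * norm x" by (intro mult_right_mono B(2)) simp
  finally have "norm ?y * norm ?y \<le> norm ?y * (B * norm x)" by (simp add: mult_ac)
  then show ?thesis
    using B(1) by (cases "norm ?y = 0") (simp_all add: mult_le_cancel_left)
qed

lemma norm_increasing_imp_norm_le:
  assumes T: "bounded_clinear T" and "norm_increasing T"
  shows "norm x \<le> norm (T x)"
proof -
  have "Re (cinner (defect 1 T x) x) \<le> 0"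
    using assms(2) unfolding norm_increasing_def nonpos_operator_def by blast
  then have "0 \<le> forward_difference 1 (\<lambda>k. (norm ((T ^^ k) x))\<^sup>2)"
    using inner_defect[OF T, of 1 x] by (simp add: Re_cinner)
  then show ?thesis by (simp add: forward_difference_def)
qed

locale norm_increasing_operator =
  fixes T :: "'a::complex_hilbert \<Rightarrow> 'a"
  assumes clinear: "bounded_clinear T" and norm_le: "norm x \<le> norm (T x)"
begin

sublocale bounded_linear T
  using clinear by (rule bounded_clinear_bounded_linear)

sublocale adj: bounded_linear "cadjoint T"
  using bounded_clinear_cadjoint[OF clinear] by (rule bounded_clinear_bounded_linear)

abbreviation Gram :: "'a \<Rightarrow> 'a" where "Gram \<equiv> cadjoint T \<circ> T"

lemma inner_Gram: "inner x (Gram y) = inner (T x) (T y)"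
  by (simp add: inner_cadjoint[OF clinear])

lemma norm_le_Gram: "norm x \<le> norm (Gram x)"
proof -
  have "(norm x)\<^sup>2 \<le> (norm (T x))\<^sup>2" by (intro power_mono norm_le) simp
  also have "\<dots> = inner x (Gram x)" by (simp only: inner_Gram power2_norm_eq_inner)
  also have "\<dots> \<le> norm x * norm (Gram x)" by (rule norm_cauchy_schwarz)
  finally show ?thesis
    by (cases "norm x = 0") (auto simp: power2_eq_square mult_le_cancel_left)
qed

lemma bounded_linear_Gram: "bounded_linear Gram"
  unfolding comp_def by (rule bounded_linear_compose) unfold_locales

text \<open>The operator \<open>T\<^sup>*T\<close> is bounded below, so its range is closed; it is dense since a vector \<open>x\<close>
  orthogonal to it has \<open>(norm (T x))\<^sup>2 = inner x (Gram x) = 0\<close>. This makes the function inverse in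
  the definition of the Cauchy dual a genuine right inverse.\<close>

lemma surj_Gram: "surj Gram"
proof (rule closed_subspace_eq_UNIV)
  interpret G: bounded_linear Gram by (rule bounded_linear_Gram)
  show "subspace (range Gram)"
    using linear_subspace_image[OF G.linear subspace_UNIV] .
  have "complete (range Gram)"
    by (rule complete_isometric_image[of 1])
      (use norm_le_Gram bounded_linear_Gram in \<open>simp_all add: complete_UNIV\<close>)
  then show "closed (range Gram)" by (rule complete_imp_closed)
  fix x assume "\<And>y. y \<in> range Gram \<Longrightarrow> inner x y = 0"
  then have "inner x (Gram x) = 0" by blast
  then have "T x = 0" unfolding inner_Gram by simp
  then show "x = 0" using norm_le[of x] by simp
qed

lemma Gram_inv: "Gram (inv Gram x) = x"
  by (rule surj_f_inv_f[OF surj_Gram])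

lemma cauchy_dual_eq: "cauchy_dual T x = T (inv Gram x)"
  by (simp add: cauchy_dual_def)

lemma cadjoint_cauchy_dual: "cadjoint T (cauchy_dual T x) = x"
  using Gram_inv[of x] by (simp add: cauchy_dual_eq)

lemma inv_Gram_scaleC: "inv Gram (c *\<^sub>C x) = c *\<^sub>C inv Gram x"
proof -
  have "Gram (inv Gram (c *\<^sub>C x) - c *\<^sub>C inv Gram x) = 0"
    using Gram_inv[of "c *\<^sub>C x"] Gram_inv[of x]
    by (simp add: diff adj.diff bounded_clinear_scaleC[OF clinear]
        bounded_clinear_scaleC[OF bounded_clinear_cadjoint[OF clinear]])
  then show ?thesis
    using norm_le_Gram[of "inv Gram (c *\<^sub>C x) - c *\<^sub>C inv Gram x"] by simp
qed

lemma cauchy_dual_scaleC: "cauchy_dual T (c *\<^sub>C x) = c *\<^sub>C cauchy_dual T x"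
  by (simp only: cauchy_dual_eq inv_Gram_scaleC bounded_clinear_scaleC[OF clinear])

text \<open>With \<open>y = inv Gram x\<close> we have \<open>(norm y)\<^sup>2 \<le> (norm (T y))\<^sup>2 = inner y x\<close>, and \<open>T y\<close> is the Cauchy dual
  at \<open>x\<close>; expanding the square on the left yields the bound. Thus the Cauchy dual is a contraction,
  and wherever it almost preserves the norm, \<open>inv Gram\<close> almost fixes the vector, so that \<open>T\<close> and its
  Cauchy dual almost agree there.\<close>

lemma norm_inv_Gram_diff:
  "(norm (inv Gram x - x))\<^sup>2 \<le> (norm x)\<^sup>2 - (norm (cauchy_dual T x))\<^sup>2"
proof -
  let ?y = "inv Gram x"
  have dual: "(norm (cauchy_dual T x))\<^sup>2 = inner ?y x"
    using inner_Gram[of ?y ?y] by (simp only: Gram_inv cauchy_dual_eq power2_norm_eq_inner)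
  have "(norm ?y)\<^sup>2 \<le> (norm (cauchy_dual T x))\<^sup>2"
    unfolding cauchy_dual_eq by (intro power_mono norm_le) simp
  moreover have "(norm (?y - x))\<^sup>2 = (norm ?y)\<^sup>2 - 2 * inner ?y x + (norm x)\<^sup>2"
    by (simp add: power2_norm_eq_inner inner_simps inner_commute)
  ultimately show ?thesis using dual by simp
qed

lemma norm_cauchy_dual_le: "norm (cauchy_dual T x) \<le> norm x"
proof -
  have "(norm (cauchy_dual T x))\<^sup>2 \<le> (norm x)\<^sup>2"
    using norm_inv_Gram_diff[of x] zero_le_power2[of "norm (inv Gram x - x)"] by linarith
  then show ?thesis by (rule power2_le_imp_le) simp
qed

text \<open>The composition of the Cauchy dual with \<open>T\<^sup>*\<close> is the orthogonal projection onto the range of \<open>T\<close>,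
  which is the orthogonal complement of the kernel of \<open>T\<^sup>*\<close>.\<close>

lemma cauchy_dual_cadjoint:
  assumes "\<And>y. cadjoint T y = 0 \<Longrightarrow> inner x y = 0"
  shows "cauchy_dual T (cadjoint T x) = x"
proof -
  let ?z = "x - cauchy_dual T (cadjoint T x)"
  have z: "cadjoint T ?z = 0" by (simp add: adj.diff cadjoint_cauchy_dual)
  then have "inner x ?z = 0" by (rule assms)
  moreover have "inner (cauchy_dual T (cadjoint T x)) ?z = 0"
    unfolding cauchy_dual_eq[of "cadjoint T x"] inner_cadjoint[OF clinear]
    using z by (simp add: cauchy_dual_eq)
  ultimately have "inner ?z ?z = 0" by (simp add: inner_diff_left)
  then show ?thesis by simp
qed

section \<open>Approximate eigenvectors of the Cauchy dual\<close>

lemma cadjoint_approx_eigenvector_funpow: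
  assumes "(\<lambda>n. cadjoint T (x n) - d *\<^sub>C x n) \<longlonglongrightarrow> 0"
  shows "(\<lambda>n. (cadjoint T ^^ k) (x n) - d ^ k *\<^sub>C x n) \<longlonglongrightarrow> 0"
proof (induction k)
  case (Suc k)
  have "(\<lambda>n. cadjoint T ((cadjoint T ^^ k) (x n) - d ^ k *\<^sub>C x n)
          + d ^ k *\<^sub>C (cadjoint T (x n) - d *\<^sub>C x n)) \<longlonglongrightarrow> cadjoint T 0 + d ^ k *\<^sub>C 0"
    by (intro tendsto_add adj.tendsto Suc bounded_linear.tendsto[OF bounded_linear_scaleC] assms)
  moreover have "cadjoint T ((cadjoint T ^^ k) y - d ^ k *\<^sub>C y)
          + d ^ k *\<^sub>C (cadjoint T y - d *\<^sub>C y) = (cadjoint T ^^ Suc k) y - d ^ Suc k *\<^sub>C y" for y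
    using bounded_clinear_scaleC[OF bounded_clinear_cadjoint[OF clinear]]
    by (simp add: adj.diff complex_vector.scale_right_diff_distrib scaleC_scaleC mult.commute)
  ultimately show ?case by (simp add: adj.zero)
qed (simp add: scaleC_one)

lemma cauchy_dual_approx_eigenvalue_norm_le_1:
  assumes x: "\<And>n. norm (x n) = 1" and lim: "(\<lambda>n. cauchy_dual T (x n) - c *\<^sub>C x n) \<longlonglongrightarrow> 0"
  shows "cmod c \<le> 1"
proof -
  have "cmod c - 1 \<le> norm (cauchy_dual T (x n) - c *\<^sub>C x n)" for n
    using norm_triangle_ineq2[of "c *\<^sub>C x n" "cauchy_dual T (x n)"]
      norm_cauchy_dual_le[of "x n"] x[of n]
    by (simp add: norm_scaleC norm_minus_commute)
  then have "cmod c - 1 \<le> 0"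
    using tendsto_norm_zero[OF lim] by (intro LIMSEQ_le_const) auto
  then show ?thesis by simp
qed

text \<open>If \<open>d\<close> is an approximate eigenvalue of \<open>T\<^sup>*\<close>, then \<open>d ^ k\<close> is one of its \<open>k\<close>-th power, whose norm
  grows at most polynomially in \<open>k\<close> by concavity. An exponential dominated by a polynomial has base
  at most \<open>1\<close>.\<close>

lemma cadjoint_approx_eigenvalue_norm_le_1:
  assumes conc: "concave_operator m T"
    and x: "\<And>n. norm (x n) = 1" and lim: "(\<lambda>n. cadjoint T (x n) - d *\<^sub>C x n) \<longlonglongrightarrow> 0"
  shows "cmod d \<le> 1"
proof -
  obtain C where C: "C \<ge> 0" "\<And>n x. (norm ((T ^^ n) x))\<^sup>2 \<le> C * real (Suc n) ^ m * (norm x)\<^sup>2"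
    using concave_operator_growth[OF clinear conc] by blast
  have "((cmod d)\<^sup>2) ^ k \<le> C * real (Suc k) ^ m" for k
  proof -
    let ?B = "sqrt (C * real (Suc k) ^ m)"
    have B: "norm ((T ^^ k) y) \<le> ?B * norm y" for y
      using real_sqrt_le_mono[OF C(2)[of k y]] by (simp add: real_sqrt_mult)
    have "cmod d ^ k - ?B \<le> norm ((cadjoint T ^^ k) (x n) - d ^ k *\<^sub>C x n)" for n
      using norm_triangle_ineq2[of "d ^ k *\<^sub>C x n" "(cadjoint T ^^ k) (x n)"] x[of n]
        cadjoint_funpow_norm_bound[OF clinear _ B, of "x n"] C(1)
      by (simp add: norm_scaleC norm_minus_commute norm_power)
    then have "cmod d ^ k - ?B \<le> 0"
      using tendsto_norm_zero[OF cadjoint_approx_eigenvector_funpow[OF lim, of k]]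
      by (intro LIMSEQ_le_const) auto
    then have "(cmod d ^ k)\<^sup>2 \<le> ?B\<^sup>2" by (intro power_mono) auto
    then show ?thesis using C(1) by (simp add: power_commutes flip: power_mult) (simp add: mult.commute)
  qed
  then have "(cmod d)\<^sup>2 \<le> 1"
    by (rule power_le_polynomial_imp_le_1[rotated]) simp
  then show ?thesis by (simp add: abs_square_le_1)
qed

text \<open>The Cauchy dual is a contraction, which gives one inequality. It is a right inverse of
  \<open>T\<^sup>*\<close>, so applying \<open>T\<^sup>*\<close> turns an approximate eigenvector for \<open>c\<close> into one of \<open>T\<^sup>*\<close> for
  \<open>inverse c\<close>, which gives the other.\<close>

lemma cauchy_dual_approx_eigenvalue_norm_eq_1:
  assumes conc: "concave_operator m T"
    and x: "\<And>n. norm (x n) = 1" and lim: "(\<lambda>n. cauchy_dual T (x n) - c *\<^sub>C x n) \<longlonglongrightarrow> 0"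
  shows "cmod c = 1"
proof -
  have adj_scale: "cadjoint T (a *\<^sub>C y) = a *\<^sub>C cadjoint T y" for a y
    by (rule bounded_clinear_scaleC[OF bounded_clinear_cadjoint[OF clinear]])
  have "(\<lambda>n. cadjoint T (cauchy_dual T (x n) - c *\<^sub>C x n)) \<longlonglongrightarrow> cadjoint T 0"
    by (rule adj.tendsto[OF lim])
  then have adj_lim: "(\<lambda>n. x n - c *\<^sub>C cadjoint T (x n)) \<longlonglongrightarrow> 0"
    by (simp add: adj.diff adj.zero cadjoint_cauchy_dual adj_scale)
  have c: "c \<noteq> 0"
  proof
    assume "c = 0"
    with adj_lim have "(\<lambda>n. norm (x n)) \<longlonglongrightarrow> 0" using tendsto_norm_zero by fastforce
    then show False by (simp add: x LIMSEQ_const_iff)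
  qed
  have "(\<lambda>n. (- inverse c) *\<^sub>C (x n - c *\<^sub>C cadjoint T (x n))) \<longlonglongrightarrow> (- inverse c) *\<^sub>C 0"
    by (rule bounded_linear.tendsto[OF bounded_linear_scaleC adj_lim])
  then have "(\<lambda>n. cadjoint T (x n) - inverse c *\<^sub>C x n) \<longlonglongrightarrow> 0"
    using c by (simp add: complex_vector.scale_right_diff_distrib scaleC_scaleC scaleC_one)
  then have "cmod (inverse c) \<le> 1"
    by (rule cadjoint_approx_eigenvalue_norm_le_1[OF conc x])
  then have "1 \<le> cmod c" using c by (simp add: norm_divide field_simps)
  with cauchy_dual_approx_eigenvalue_norm_le_1[OF x lim] show ?thesis by simp
qed

text \<open>Since \<open>cmod c = 1\<close>, the Cauchy dual asymptotically preserves the norms of the \<open>x n\<close>, and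
  \<open>norm_inv_Gram_diff\<close> then makes \<open>inv Gram (x n) - x n\<close> tend to \<open>0\<close>. Applying \<open>T\<close> shows that \<open>T\<close> and
  its Cauchy dual agree on \<open>x n\<close> in the limit.\<close>

lemma cauchy_dual_approx_eigenvector_imp_approx_eigenvector:
  assumes c: "cmod c = 1"
    and x: "\<And>n. norm (x n) = 1" and lim: "(\<lambda>n. cauchy_dual T (x n) - c *\<^sub>C x n) \<longlonglongrightarrow> 0"
  shows "(\<lambda>n. T (x n) - c *\<^sub>C x n) \<longlonglongrightarrow> 0"
proof -
  let ?d = "\<lambda>n. inv Gram (x n) - x n"
  have "(\<lambda>n. norm (cauchy_dual T (x n)) - 1) \<longlonglongrightarrow> 0"
  proof (rule Lim_null_comparison[OF _ tendsto_norm_zero[OF lim]], rule always_eventually, rule allI)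
    fix n
    show "norm (norm (cauchy_dual T (x n)) - 1) \<le> norm (cauchy_dual T (x n) - c *\<^sub>C x n)"
      using norm_triangle_ineq3[of "cauchy_dual T (x n)" "c *\<^sub>C x n"] c x[of n]
      by (simp add: norm_scaleC)
  qed
  then have "(\<lambda>n. norm (cauchy_dual T (x n))) \<longlonglongrightarrow> 1" by (simp add: LIM_zero_iff)
  then have "(\<lambda>n. 1 - (norm (cauchy_dual T (x n)))\<^sup>2) \<longlonglongrightarrow> 1 - 1\<^sup>2"
    by (intro tendsto_intros)
  then have "(\<lambda>n. 1 - (norm (cauchy_dual T (x n)))\<^sup>2) \<longlonglongrightarrow> 0" by simp
  moreover have "norm ((norm (?d n))\<^sup>2) \<le> 1 - (norm (cauchy_dual T (x n)))\<^sup>2" for n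
    using norm_inv_Gram_diff[of "x n"] unfolding x by (simp only: real_norm_def abs_power2 power_one)
  ultimately have "(\<lambda>n. (norm (?d n))\<^sup>2) \<longlonglongrightarrow> 0"
    by (rule Lim_null_comparison[OF always_eventually[OF allI], rotated])
  then have "(\<lambda>n. sqrt ((norm (?d n))\<^sup>2)) \<longlonglongrightarrow> sqrt 0" by (rule tendsto_real_sqrt)
  then have "?d \<longlonglongrightarrow> 0" by (simp add: tendsto_norm_zero_iff)
  then have "(\<lambda>n. T (?d n)) \<longlonglongrightarrow> T 0" by (rule tendsto)
  then have "(\<lambda>n. cauchy_dual T (x n) - T (x n)) \<longlonglongrightarrow> 0"
    by (simp add: diff zero cauchy_dual_eq)
  from tendsto_diff[OF lim this] show ?thesis by simp
qed

text \<open>An eigenvector for a nonzero eigenvalue lies in the range of every power of \<open>T\<close>.\<close>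

lemma analytic_eigenvector_eq_0:
  assumes an: "analytic_operator T" and c: "c \<noteq> 0" and Tx: "T x = c *\<^sub>C x"
  shows "x = 0"
proof -
  have "y \<in> range (T ^^ n)" if "T y = c *\<^sub>C y" for n y
    using that
  proof (induction n arbitrary: y)
    case (Suc n)
    let ?z = "inverse c *\<^sub>C y"
    have Tz: "T ?z = y"
      using c Suc.prems
      by (simp add: bounded_clinear_scaleC[OF clinear] scaleC_scaleC scaleC_one)
    then have "T ?z = c *\<^sub>C ?z" using c by (simp add: scaleC_scaleC scaleC_one)
    then obtain w where "?z = (T ^^ n) w" using Suc.IH by blast
    then have "y = (T ^^ Suc n) w" using Tz by simp
    then show ?case by blast
  qed simp
  with Tx an show ?thesis unfolding analytic_operator_def by blast
qed

text \<open>Against a vector in the range of the adjoint of \<open>T - c\<close> the inner products tend to \<open>0\<close> directly.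
  This range is dense, as its orthogonal complement is the kernel of \<open>T - c\<close>, which is trivial by
  analyticity; a bounded sequence is controlled by a dense set of test vectors.\<close>

lemma analytic_approx_eigenvector_weakly_null:
  assumes an: "analytic_operator T" and c: "c \<noteq> 0"
    and x: "\<And>n. norm (x n) = 1" and lim: "(\<lambda>n. T (x n) - c *\<^sub>C x n) \<longlonglongrightarrow> 0"
  shows "weakly_null x"
proof -
  let ?A = "\<lambda>z. cadjoint T z - cnj c *\<^sub>C z"
  have A: "inner y (?A z) = inner (T y - c *\<^sub>C y) z" for y z
    by (simp add: inner_diff_right inner_diff_left inner_cadjoint[OF clinear] inner_scaleC_right)
  have "bounded_linear ?A"
    by (intro bounded_linear_sub bounded_linear_scaleC adj.bounded_linear_axioms)
  then have "subspace (closure (range ?A))"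
    by (intro subspace_closure linear_subspace_image bounded_linear.linear subspace_UNIV)
  then have dense: "closure (range ?A) = UNIV"
  proof (rule closed_subspace_eq_UNIV)
    fix y assume y: "\<And>z. z \<in> closure (range ?A) \<Longrightarrow> inner y z = 0"
    have "inner y (?A (T y - c *\<^sub>C y)) = 0"
      by (intro y subsetD[OF closure_subset] rangeI)
    then have "T y = c *\<^sub>C y" unfolding A by simp
    then show "y = 0" by (rule analytic_eigenvector_eq_0[OF an c])
  qed simp
  have range_lim: "(\<lambda>n. inner (x n) (?A z)) \<longlonglongrightarrow> 0" for z
    using tendsto_inner[OF lim tendsto_const[of z]] unfolding A by simp
  have inner_lim: "(\<lambda>n. inner (x n) y) \<longlonglongrightarrow> 0" for y
  proof (rule LIMSEQ_I)
    fix e :: real assume e: "e > 0"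
    have "y \<in> closure (range ?A)" unfolding dense by (rule UNIV_I)
    then obtain w where w: "w \<in> range ?A" "dist w y < e / 2"
      using e unfolding closure_approachable by (meson half_gt_zero)
    then obtain z where "w = ?A z" by blast
    with w(2) have z: "norm (y - ?A z) < e / 2" by (simp add: dist_norm norm_minus_commute)
    obtain N where N: "\<And>n. n \<ge> N \<Longrightarrow> \<bar>inner (x n) (?A z)\<bar> < e / 2"
      using LIMSEQ_D[OF range_lim, of "e / 2" z] e by auto
    have "\<bar>inner (x n) y\<bar> < e" if "n \<ge> N" for n
    proof -
      have "inner (x n) y = inner (x n) (?A z) + inner (x n) (y - ?A z)"
        by (simp add: inner_diff_right)
      moreover have "\<bar>inner (x n) (y - ?A z)\<bar> \<le> norm (y - ?A z)"
        using Cauchy_Schwarz_ineq2[of "x n" "y - ?A z"] x by simp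
      ultimately show ?thesis using N[OF that] z by linarith
    qed
    then show "\<exists>N. \<forall>n\<ge>N. norm (inner (x n) y - 0) < e" by auto
  qed
  have "inner (- \<i> *\<^sub>C x n) y = inner (x n) (\<i> *\<^sub>C y)" for n y
    by (simp add: inner_scaleC_right)
  then have "(\<lambda>n. cinner (x n) y) \<longlonglongrightarrow> Complex 0 0" for y
    unfolding cinner_conv_inner by (simp add: tendsto_Complex inner_lim)
  then show ?thesis unfolding weakly_null_def by (simp add: zero_complex.code)
qed

lemma cauchy_dual_approx_eigenvector_weyl_sequence:
  assumes conc: "concave_operator m T" and an: "analytic_operator T"
    and x: "\<And>n. norm (x n) = 1" and lim: "(\<lambda>n. cauchy_dual T (x n) - c *\<^sub>C x n) \<longlonglongrightarrow> 0"
  shows "weyl_sequence c T x" "weyl_sequence c (cauchy_dual T) x"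
proof -
  have c: "cmod c = 1" by (rule cauchy_dual_approx_eigenvalue_norm_eq_1[OF conc x lim])
  have T_lim: "(\<lambda>n. T (x n) - c *\<^sub>C x n) \<longlonglongrightarrow> 0"
    by (rule cauchy_dual_approx_eigenvector_imp_approx_eigenvector[OF c x lim])
  have "weakly_null x"
    using c by (intro analytic_approx_eigenvector_weakly_null[OF an _ x T_lim]) auto
  with x lim T_lim show "weyl_sequence c T x" "weyl_sequence c (cauchy_dual T) x"
    by (auto simp: weyl_sequence_def)
qed

text \<open>A unit eigenvector would give a constant Weyl sequence, which cannot be weakly null.\<close>

lemma cauchy_dual_no_eigenvector:
  assumes conc: "concave_operator m T" and an: "analytic_operator T"
    and ev: "cauchy_dual T v = c *\<^sub>C v" and v: "norm v = 1"
  shows False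
proof -
  have "weyl_sequence c T (\<lambda>_. v)"
    using cauchy_dual_approx_eigenvector_weyl_sequence(1)[OF conc an, of "\<lambda>_. v" c] ev v by simp
  then have "(\<lambda>_::nat. cinner v v) \<longlonglongrightarrow> 0"
    unfolding weyl_sequence_def weakly_null_def by blast
  then have "cinner v v = 0" by (simp add: LIMSEQ_const_iff)
  with v show False by (simp add: cinner_self)
qed

section \<open>The complement of the wandering part\<close>

abbreviation wandering_complement :: "'a set"
  where "wandering_complement \<equiv>
    corthogonal_complement (generated_invariant T (op_kernel (cadjoint T)))"

lemma mem_wandering_complement_iff:
  "x \<in> wandering_complement \<longleftrightarrow> (\<forall>n h. cadjoint T h = 0 \<longrightarrow> cinner x ((T ^^ n) h) = 0)"
proof
  let ?G = "{(T ^^ n) h | n h. h \<in> op_kernel (cadjoint T)}"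
  have "?G \<subseteq> generated_invariant T (op_kernel (cadjoint T))"
    unfolding generated_invariant_def
    by (rule order_trans[OF complex_vector.span_superset closure_subset])
  then show "\<forall>n h. cadjoint T h = 0 \<longrightarrow> cinner x ((T ^^ n) h) = 0" if "x \<in> wandering_complement"
    using that unfolding corthogonal_complement_def op_kernel_def by blast
  assume orth: "\<forall>n h. cadjoint T h = 0 \<longrightarrow> cinner x ((T ^^ n) h) = 0"
  let ?N = "{y. cinner x y = 0}"
  have "closed ?N"
    unfolding cinner_conv_inner complex_eq_iff complex.sel
    by (intro closed_Collect_conj closed_Collect_eq continuous_intros)
  moreover have "cinner x (y + z) = cinner x y + cinner x z" for y z
    by (metis cinner_commute cinner_add_left complex_cnj_add)
  then have "complex_vector.subspace ?N"
    by (auto simp: complex_vector.subspace_def cinner_scaleC_right cinner_conv_inner[of x 0]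
        zero_complex.code)
  moreover have "?G \<subseteq> ?N" using orth by (auto simp: op_kernel_def)
  ultimately have "generated_invariant T (op_kernel (cadjoint T)) \<subseteq> ?N"
    unfolding generated_invariant_def
    by (intro closure_minimal complex_vector.span_minimal)
  then show "x \<in> wandering_complement" unfolding corthogonal_complement_def by blast
qed

lemma cadjoint_wandering_complement:
  "x \<in> wandering_complement \<Longrightarrow> cadjoint T x \<in> wandering_complement"
  unfolding mem_wandering_complement_iff
proof (intro allI impI)
  fix n h assume x: "\<forall>n h. cadjoint T h = 0 \<longrightarrow> cinner x ((T ^^ n) h) = 0" and h: "cadjoint T h = 0"
  have "cinner (cadjoint T x) ((T ^^ n) h) = cnj (cinner (T ((T ^^ n) h)) x)"
    by (metis cinner_commute cinner_cadjoint[OF clinear])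
  also have "\<dots> = cinner x ((T ^^ Suc n) h)" by (simp flip: cinner_commute)
  also have "\<dots> = 0" using x h by blast
  finally show "cinner (cadjoint T x) ((T ^^ n) h) = 0" .
qed

lemma wandering_complement_nonzero:
  assumes "\<not> wandering_subspace_property T"
  obtains x where "x \<in> wandering_complement" "x \<noteq> 0"
proof -
  let ?C = "cspan {(T ^^ n) h | n h. h \<in> op_kernel (cadjoint T)}"
  have complex: "c *\<^sub>C y \<in> ?C" if "y \<in> ?C" for c y
    using that by (rule complex_vector.span_scale)
  have "subspace ?C"
    unfolding subspace_def scaleR_scaleC
    by (auto intro: complex complex_vector.span_zero complex_vector.span_add)
  then have "subspace (closure ?C)" by (rule subspace_closure)
  moreover have "closure ?C \<noteq> UNIV"
    using assms unfolding wandering_subspace_property_def generated_invariant_def .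
  ultimately obtain x where x: "\<And>y. y \<in> closure ?C \<Longrightarrow> inner x y = 0" "x \<noteq> 0"
    using closed_subspace_eq_UNIV[OF _ closed_closure, of ?C] by blast
  have "cinner x ((T ^^ n) h) = 0" if h: "cadjoint T h = 0" for n h
  proof -
    have g: "(T ^^ n) h \<in> ?C"
      using h by (intro complex_vector.span_base) (auto simp: op_kernel_def)
    have "inner x ((T ^^ n) h) = 0" "inner x (\<i> *\<^sub>C (T ^^ n) h) = 0"
      using g complex[OF g] by (auto intro!: x(1) subsetD[OF closure_subset])
    then show ?thesis
      by (simp add: cinner_conv_inner inner_scaleC_right zero_complex.code)
  qed
  with x(2) that show thesis unfolding mem_wandering_complement_iff by blast
qed

text \<open>The complement is invariant under \<open>T\<^sup>*\<close>, so in finite dimension it would contain an eigenvector of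
  \<open>T\<^sup>*\<close>. On the complement, which is orthogonal to the kernel of \<open>T\<^sup>*\<close>, the Cauchy dual inverts
  \<open>T\<^sup>*\<close>, so this would also be an eigenvector of the Cauchy dual.\<close>

lemma wandering_complement_infinite_dimensional:
  assumes conc: "concave_operator m T" and an: "analytic_operator T"
    and nw: "\<not> wandering_subspace_property T"
  shows "infinite_dimensional wandering_complement"
  unfolding infinite_dimensional_def
proof
  assume "\<exists>B. finite B \<and> cspan B = wandering_complement"
  then obtain B where B: "finite B" "wandering_complement = cspan B" by metis
  obtain x where x: "x \<in> wandering_complement" "x \<noteq> 0"
    using wandering_complement_nonzero[OF nw] .
  obtain d v where v: "v \<in> wandering_complement" "v \<noteq> 0" "cadjoint T v = d *\<^sub>C v"
    using finite_dimensional_imp_eigenvector[OF adj.add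
        bounded_clinear_scaleC[OF bounded_clinear_cadjoint[OF clinear]] B
        cadjoint_wandering_complement x]
    by blast
  define u where "u = (inverse (norm v)) *\<^sub>R v"
  have norm_u: "norm u = 1" using v(2) by (simp add: u_def)
  have adj_u: "cadjoint T u = d *\<^sub>C u"
    by (simp only: u_def adj.scaleR v(3)) (simp only: scaleR_scaleC scaleC_scaleC mult.commute)
  have "cinner v y = 0" if "cadjoint T y = 0" for y
    using v(1) that unfolding mem_wandering_complement_iff by (metis funpow_0)
  then have "inner v y = 0" if "cadjoint T y = 0" for y
    using that by (metis Re_cinner zero_complex.sel(1))
  then have "inner u y = 0" if "cadjoint T y = 0" for y
    using that by (simp add: u_def)
  then have dual: "cauchy_dual T (d *\<^sub>C u) = u"
    unfolding adj_u[symmetric] by (rule cauchy_dual_cadjoint)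
  have d: "d \<noteq> 0"
  proof
    assume "d = 0"
    with dual have "cauchy_dual T 0 = u" by simp
    then show False using norm_cauchy_dual_le[of 0] norm_u by simp
  qed
  have "cauchy_dual T u = inverse d *\<^sub>C u"
    using dual d cauchy_dual_scaleC[of "inverse d" "d *\<^sub>C u"] by (simp add: scaleC_scaleC scaleC_one)
  then show False by (rule cauchy_dual_no_eigenvector[OF conc an _ norm_u])
qed

end

theorem theorem1p1:
  fixes m :: nat and T T' :: "'a::complex_hilbert \<Rightarrow> 'a" and M :: "'a set"
  assumes "m \<ge> 2"
    and "bounded_clinear T"
    and "analytic_operator T"
    and "norm_increasing T"
    and "concave_operator m T"
    and "T' = cauchy_dual T"
    and "M = corthogonal_complement (generated_invariant T (op_kernel (cadjoint T)))"
    and "\<not> wandering_subspace_property T"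
  shows "(\<forall>c \<in> approx_point_spectrum_on M T'.
            \<exists>u. (\<forall>n. u n \<in> M) \<and> weyl_sequence c T u \<and> weyl_sequence c T' u)
         \<and> infinite_dimensional M"
proof -
  have T: "norm_increasing_operator T"
    using assms(2) norm_increasing_imp_norm_le[OF assms(2,4)]
    by (rule norm_increasing_operator.intro)
  show ?thesis
  proof (intro conjI ballI)
    fix c assume "c \<in> approx_point_spectrum_on M T'"
    then obtain u where u: "\<And>n. u n \<in> M" "\<And>n. norm (u n) = 1"
        "(\<lambda>n. T' (u n) - c *\<^sub>C u n) \<longlonglongrightarrow> 0"
      unfolding approx_point_spectrum_on_def by blast
    then have "weyl_sequence c T u \<and> weyl_sequence c T' u"
      using norm_increasing_operator.cauchy_dual_approx_eigenvector_weyl_sequence[OF T assms(5,3)]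
      unfolding assms(6) by blast
    with u(1) show "\<exists>u. (\<forall>n. u n \<in> M) \<and> weyl_sequence c T u \<and> weyl_sequence c T' u"
      by blast
  next
    show "infinite_dimensional M"
      unfolding assms(7) 
      by (rule norm_increasing_operator.wandering_complement_infinite_dimensional[OF T assms(5,3,8)])
  qed
qed

end
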